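(* For an integer $h\geq 1$ let $\Gamma_{3^h}$ denote the multiplicative circulant graph $MC(3^h)$. For every integer $h\geq 2$, $diam(\Gamma_{3^h})=diam(\Gamma_{3^{h-1}})+1$.
   Context: For integers $m>1$, $h>0$, $MC(m^h)$ is the graph with vertex set $\mathbb{Z}_{m^h}$ in which distinct vertices $x,y$ are adjacent iff $x-y\equiv \pm m^i \pmod{m^h}$ for some $i\in\{0,\ldots,h-1\}$. $diam(\Gamma)$ is the maximum distance (shortest path length) between any pair of vertices of $\Gamma$. *)

theory Defs
  imports "Graph_Theory.Graph_Theory" "HOL-Number_Theory.Cong"
begin

text \<open>
  Undirected simple graphs are loop-free symmetric digraphs (locale \<^locale>\<open>pair_graph\<close>), and
  the residue ring modulo \<open>m ^ h\<close> is represented by the least nonnegative residues.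
\<close>

definition MC :: "int \<Rightarrow> nat \<Rightarrow> int pair_pre_digraph" where
  "MC m h = \<lparr> pverts = {0..<m ^ h},
     parcs = {(x, y). x \<in> {0..<m ^ h} \<and> y \<in> {0..<m ^ h} \<and> x \<noteq> y \<and>
       (\<exists>i\<in>{0..<h}. [x - y = m ^ i] (mod m ^ h) \<or> [x - y = - (m ^ i)] (mod m ^ h))} \<rparr>"

text \<open>
  With unit weights, \<open>wf_digraph.\<mu>\<close> is the shortest path length, and it is infinite for
  unreachable pairs. The maximum is meaningful for finite nonempty graphs.
\<close>

definition graph_dist :: "('a, 'b) pre_digraph \<Rightarrow> 'a \<Rightarrow> 'a \<Rightarrow> ereal" where
  "graph_dist G u v = wf_digraph.\<mu> G (\<lambda>_. 1) u v"

definition diam :: "('a, 'b) pre_digraph \<Rightarrow> ereal" where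
  "diam G = Max {graph_dist G u v | u v. u \<in> verts G \<and> v \<in> verts G}"

lemma pair_graph_MC: "pair_graph (MC m h)"
proof -
  have fin: "finite (parcs (MC m h))"
    by (rule finite_subset[of _ "{0..<m ^ h} \<times> {0..<m ^ h}"]) (auto simp: MC_def)
  have sym: "(y, x) \<in> parcs (MC m h)" if "(x, y) \<in> parcs (MC m h)" for x y
  proof -
    from that obtain i where i: "i \<in> {0..<h}"
      and c: "[x - y = m ^ i] (mod m ^ h) \<or> [x - y = - (m ^ i)] (mod m ^ h)"
      and xy: "x \<in> {0..<m ^ h}" "y \<in> {0..<m ^ h}" "x \<noteq> y"
      by (auto simp: MC_def)
    from c have "[y - x = m ^ i] (mod m ^ h) \<or> [y - x = - (m ^ i)] (mod m ^ h)"
      using cong_minus_minus_iff[of "x - y" "m ^ i" "m ^ h"]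
        cong_minus_minus_iff[of "x - y" "- (m ^ i)" "m ^ h"] by auto
    with i xy show ?thesis by (auto simp: MC_def)
  qed
  show ?thesis
    by unfold_locales (use fin sym in \<open>auto simp: MC_def symmetric_def intro!: symI\<close>)
qed

lemma strongly_connected_MC:
  assumes "m > 1" "h > 0"
  shows "strongly_connected (MC m h)"
proof -
  interpret pair_graph "MC m h" by (rule pair_graph_MC)
  have verts: "pverts (MC m h) = {0..<m ^ h}" by (simp add: MC_def)
  have pos: "m ^ h > 0" using assms by simp
  have arc: "(x + 1, x) \<in> parcs (MC m h)" if "0 \<le> x" "x + 1 < m ^ h" for x
    using that assms by (auto simp: MC_def intro!: bexI[of _ 0])
  have "int n < m ^ h \<Longrightarrow> int n \<rightarrow>\<^sup>*\<^bsub>with_proj (MC m h)\<^esub> 0" for n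
  proof (induction n)
    case 0
    then show ?case by (auto simp: verts)
  next
    case (Suc n)
    then have "(int n + 1, int n) \<in> parcs (MC m h)" by (intro arc) auto
    with Suc show ?case by (auto simp: add.commute intro: adj_reachable_trans)
  qed
  then have to0: "x \<rightarrow>\<^sup>*\<^bsub>with_proj (MC m h)\<^esub> 0" if "x \<in> {0..<m ^ h}" for x
    using that by (metis atLeastLessThan_iff nonneg_int_cases)
  then have "x \<rightarrow>\<^sup>*\<^bsub>with_proj (MC m h)\<^esub> y" if "x \<in> {0..<m ^ h}" "y \<in> {0..<m ^ h}" for x y
    using that by (meson reachable_trans symmetric_reachable sym_arcs)
  then show ?thesis
    using pos by (auto simp: strongly_connected_def verts)
qed

end

theory Submission
  imports Defs
begin

text \<open>
  Both diameters are computed exactly: \<open>MC 3 h\<close> has diameter \<open>h\<close>. A difference of two vertices has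
  a balanced ternary expansion with \<open>h\<close> digits from \<open>{-1, 0, 1}\<close>, and clearing the digits from the
  lowest to the highest gives a walk of length at most \<open>h\<close>. Conversely, the number of nonzero
  balanced ternary digits changes by at most one along an edge; it vanishes at \<open>0\<close> and equals \<open>h\<close>
  at \<open>(3 ^ h - 1) / 2\<close>, all of whose digits are \<open>1\<close>.
\<close>

text \<open>
  The lowest balanced ternary digit of \<open>x\<close> is \<open>(x + 1) mod 3 - 1\<close>, so that the remaining digits are
  those of \<open>(x + 1) div 3\<close>. Only the lowest \<open>h\<close> digits are counted.
\<close>

primrec balanced_ternary_weight :: "nat \<Rightarrow> int \<Rightarrow> nat" where
  "balanced_ternary_weight 0 x = 0"
| "balanced_ternary_weight (Suc h) x =
     (if 3 dvd x then 0 else 1) + balanced_ternary_weight h ((x + 1) div 3)"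

lemma balanced_ternary_weight_zero [simp]: "balanced_ternary_weight h 0 = 0"
  by (induction h) auto

lemma balanced_ternary_weight_add_multiple:
  "balanced_ternary_weight h (x + 3 ^ h * k) = balanced_ternary_weight h x"
proof (induction h arbitrary: x)
  case (Suc h)
  have "(x + 3 ^ Suc h * k + 1) div 3 = (x + 1) div 3 + 3 ^ h * k"
    using div_mult_self1[of 3 "x + 1" "3 ^ h * k"] by (simp add: algebra_simps)
  moreover have "3 dvd x + 3 ^ Suc h * k \<longleftrightarrow> 3 dvd x"
    by (simp add: dvd_add_left_iff)
  ultimately show ?case
    using Suc.IH by simp
qed simp

lemma balanced_ternary_weight_cong:
  assumes "[x = y] (mod 3 ^ h)"
  shows "balanced_ternary_weight h x = balanced_ternary_weight h y"
proof -
  obtain k where "y = x + 3 ^ h * k"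
    using assms by (auto simp: cong_iff_lin)
  then show ?thesis
    by (simp add: balanced_ternary_weight_add_multiple)
qed

text \<open>A digit other than \<open>s\<close> absorbs the change at position \<open>i\<close>. A
  digit equal to \<open>s\<close> turns into \<open>-s\<close> and passes a carry \<open>s\<close>
  upwards, which is again an addition of \<open>s\<close> times a power; hence the generalization
  over \<open>i\<close> in the induction.\<close>

lemma balanced_ternary_weight_add_power_le:
  assumes "s = 1 \<or> s = -1"
  shows "balanced_ternary_weight h (x + s * 3 ^ i) \<le> balanced_ternary_weight h x + 1"
proof (induction h arbitrary: x i)
  case (Suc h)
  show ?case
  proof (cases i)
    case 0
    show ?thesis
    proof (cases "3 dvd x - s")
      case True
      text \<open>The carry is harmless because the lowest digit is nonzero before and after.\<close>
      have "\<not> 3 dvd x" "\<not> 3 dvd x + s" "(x + s + 1) div 3 = (x + 1) div 3 + s"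
        using assms True by (elim disjE; hypsubst; presburger)+
      then show ?thesis
        using Suc.IH[of "(x + 1) div 3" 0] 0 by simp
    next
      case False
      have "(x + s + 1) div 3 = (x + 1) div 3"
        using assms False by (elim disjE; hypsubst; presburger)
      then show ?thesis
        using 0 by simp
    qed
  next
    case (Suc j)
    have "(x + s * 3 ^ i + 1) div 3 = (x + 1) div 3 + s * 3 ^ j"
      using div_mult_self1[of 3 "x + 1" "s * 3 ^ j"] Suc by (simp add: algebra_simps)
    moreover have "3 dvd x + s * 3 ^ i \<longleftrightarrow> 3 dvd x"
      using Suc by (simp add: dvd_add_left_iff)
    ultimately show ?thesis
      using Suc.IH[of "(x + 1) div 3" j] by simp
  qed
qed simp

lemma balanced_ternary_weight_full: "\<exists>x\<in>{0..<3 ^ h}. balanced_ternary_weight h x = h"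
proof (induction h)
  case (Suc h)
  then obtain x where x: "0 \<le> x" "x < 3 ^ h" "balanced_ternary_weight h x = h"
    by auto
  \<comment> \<open>Passing from \<open>x\<close> to \<open>3 * x + 1\<close> appends a lowest digit
    1.\<close>
  have "\<not> 3 dvd 3 * x + 1" "(3 * x + 1 + 1) div 3 = x"
    by presburger+
  then have "balanced_ternary_weight (Suc h) (3 * x + 1) = Suc h"
    using x by simp
  moreover have "3 * x + 1 \<in> {0..<3 ^ Suc h}"
    using x by simp
  ultimately show ?case
    by blast
qed (auto intro!: bexI[of _ 0])

lemma balanced_ternary_weight_arc_le:
  assumes "(x, y) \<in> parcs (MC 3 h)"
  shows "balanced_ternary_weight h x \<le> balanced_ternary_weight h y + 1"
proof -
  obtain i where "[x - y = 3 ^ i] (mod 3 ^ h) \<or> [x - y = - (3 ^ i)] (mod 3 ^ h)"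
    using assms by (auto simp: MC_def)
  then obtain s :: int where s: "s = 1 \<or> s = -1" "[x - y = s * 3 ^ i] (mod 3 ^ h)"
    by (metis mult_1 mult_minus1)
  then have "[x = y + s * 3 ^ i] (mod 3 ^ h)"
    by (simp add: cong_iff_dvd_diff algebra_simps)
  then show ?thesis
    using balanced_ternary_weight_cong balanced_ternary_weight_add_power_le[OF s(1)] by metis
qed

lemma wf_digraph_MC: "wf_digraph (MC m h)"
  by unfold_locales (auto simp: MC_def)

lemma balanced_ternary_weight_le_awalk_length:
  assumes "pre_digraph.awalk (MC 3 h) u p v"
  shows "balanced_ternary_weight h u \<le> balanced_ternary_weight h v + length p"
proof -
  interpret wf_digraph "with_proj (MC 3 h)" by (rule wf_digraph_MC)
  show ?thesis
    using assms
  proof (induction p arbitrary: u)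
    case (Cons e p)
    then have "(u, snd e) \<in> parcs (MC 3 h)" "awalk (snd e) p v"
      by (auto simp: awalk_Cons_iff)
    then show ?case
      using Cons.IH[of "snd e"] balanced_ternary_weight_arc_le by fastforce
  qed (simp add: awalk_Nil_iff)
qed

text \<open>The congruence says that the lowest \<open>h - k\<close> digits of the difference are
  already cleared. Each of the \<open>k\<close> remaining positions costs at most one arc.\<close>

lemma ex_awalk_MC_le:
  assumes "k \<le> h" "u \<in> {0..<3 ^ h}" "v \<in> {0..<3 ^ h}" "[u - v = 3 ^ (h - k) * t] (mod 3 ^ h)"
  shows "\<exists>p. pre_digraph.awalk (MC 3 h) u p v \<and> length p \<le> k"
proof -
  interpret wf_digraph "with_proj (MC 3 h)" by (rule wf_digraph_MC)
  have verts: "verts (MC 3 h) = {0..<3 ^ h}"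
    by (simp add: MC_def)
  show ?thesis
    using assms
  proof (induction k arbitrary: u t)
    case 0
    then have "[u - v = 0] (mod 3 ^ h)"
      by (simp add: cong_def)
    then have "[u = v] (mod 3 ^ h)"
      by (simp add: cong_iff_dvd_diff)
    then have "u = v"
      using 0 by (simp add: cong_def)
    then show ?case
      using 0 verts by (intro exI[of _ "[]"]) (simp add: awalk_Nil_iff)
  next
    case (Suc k)
    define i where "i = h - Suc k"
    have i: "i < h" "h - k = Suc i"
      using Suc.prems by (auto simp: i_def)
    \<comment> \<open>Here \<open>r\<close> is the balanced digit at position \<open>i\<close>, the
      lowest one not yet cleared, and \<open>q\<close> carries the higher digits.\<close>
    define r q where "r = (t + 1) mod 3 - 1" and "q = (t + 1) div 3"
    have t: "t = 3 * q + r" and r: "r = 0 \<or> r = 1 \<or> r = -1"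
      unfolding r_def q_def by presburger+
    define u' where "u' = (u - r * 3 ^ i) mod 3 ^ h"
    have u': "u' \<in> {0..<3 ^ h}" and cong_u': "[u' = u - r * 3 ^ i] (mod 3 ^ h)"
      by (auto simp: u'_def cong_def)
    have "[u' - v = (u - v) - r * 3 ^ i] (mod 3 ^ h)"
      using cong_diff[OF cong_u' cong_refl[of v]] by (simp add: algebra_simps)
    also have "[(u - v) - r * 3 ^ i = 3 ^ i * t - r * 3 ^ i] (mod 3 ^ h)"
      using cong_diff[OF Suc.prems(4) cong_refl[of "r * 3 ^ i"]] by (simp add: i_def)
    also have "3 ^ i * t - r * 3 ^ i = 3 ^ (h - k) * q"
      by (simp add: t i algebra_simps)
    finally obtain p where p: "awalk u' p v" "length p \<le> k"
      using Suc.IH[OF _ u' Suc.prems(3)] Suc.prems(1) by auto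
    show ?case
    \<comment> \<open>A zero digit leaves the vertex in place and needs no arc.\<close>
    proof (cases "u = u'")
      case True
      then show ?thesis
        using p by (metis le_SucI)
    next
      case False
      then have "r \<noteq> 0"
        using Suc.prems(2) by (auto simp: u'_def)
      moreover have "[u - u' = r * 3 ^ i] (mod 3 ^ h)"
        using cong_diff[OF cong_refl[of u] cong_u'] by simp
      ultimately have "(u, u') \<in> parcs (MC 3 h)"
        using r i(1) False Suc.prems(2) u' by (auto simp: MC_def)
      then have "awalk u ((u, u') # p) v"
        using p(1) by (simp add: awalk_Cons_iff)
      then show ?thesis
        using p(2) by (metis Suc_le_mono length_Cons)
    qed
  qed
qed

text \<open>In this form a single walk bounds the distance from above, and a bound on all walks
  bounds it from below.\<close>

lemma graph_dist_eq_INF_length: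
  assumes "wf_digraph G"
  shows "graph_dist G u v = (INF p\<in>{p. pre_digraph.awalk G u p v}. ereal (real (length p)))"
proof -
  interpret wf_digraph G by fact
  have "awalk_cost (\<lambda>_. 1) p = length p" for p
    by (induction p) auto
  then show ?thesis
    by (simp add: graph_dist_def \<mu>_def)
qed

lemma graph_dist_MC_3_le:
  assumes "u \<in> {0..<3 ^ h}" "v \<in> {0..<3 ^ h}"
  shows "graph_dist (MC 3 h) u v \<le> ereal (real h)"
proof -
  obtain p where "pre_digraph.awalk (MC 3 h) u p v" "length p \<le> h"
    \<comment> \<open>With \<open>k = h\<close> the factor \<open>3 ^ (h - k)\<close> is 1, so
      \<open>t = u - v\<close> satisfies the congruence trivially.\<close>
    using ex_awalk_MC_le[OF order_refl assms, of "u - v"] by auto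
  then show ?thesis
    unfolding graph_dist_eq_INF_length[OF wf_digraph_MC] by (intro INF_lower2[of p]) auto
qed

text \<open>The target 0 has weight 0, so the length of a walk alone must account for the weight of
  \<open>u\<close>.\<close>

lemma balanced_ternary_weight_le_graph_dist:
  "ereal (real (balanced_ternary_weight h u)) \<le> graph_dist (MC 3 h) u 0"
  unfolding graph_dist_eq_INF_length[OF wf_digraph_MC]
  by (rule INF_greatest) (auto dest: balanced_ternary_weight_le_awalk_length)

lemma diam_MC_3: "diam (MC 3 h) = ereal (real h)"
proof -
  let ?V = "{0..<3 ^ h} :: int set"
  have verts: "verts (MC 3 h) = ?V"
    by (simp add: MC_def)
  \<comment> \<open>As the image of a finite product, the set of distances is visibly finite, as
    \<open>Max\<close> requires.\<close>
  have D: "{graph_dist (MC 3 h) u v | u v. u \<in> verts (MC 3 h) \<and> v \<in> verts (MC 3 h)}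
      = (\<lambda>(u, v). graph_dist (MC 3 h) u v) ` (?V \<times> ?V)"
    unfolding verts image_def by (force simp del: atLeastLessThan_iff)
  obtain x where x: "x \<in> ?V" "balanced_ternary_weight h x = h"
    using balanced_ternary_weight_full by blast
  have "graph_dist (MC 3 h) x 0 = ereal (real h)"
    using x graph_dist_MC_3_le[of x h 0] balanced_ternary_weight_le_graph_dist[of h x] by auto
  then have "ereal (real h) \<in> (\<lambda>(u, v). graph_dist (MC 3 h) u v) ` (?V \<times> ?V)"
    using x(1) by (intro image_eqI[of _ _ "(x, 0)"]) auto
  then show ?thesis
    unfolding diam_def D by (intro Max_eqI) (auto intro: graph_dist_MC_3_le)
qed

theorem theorem3p16:
  fixes h :: nat
  assumes "h \<ge> 2"
  shows "diam (MC 3 h) = diam (MC 3 (h - 1)) + 1"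
  using assms by (simp add: diam_MC_3 of_nat_diff one_ereal_def)

end
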